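(* Let $r,n\ge 1$ be integers. Then $$\sum_{\pi\in G(r,n)}(-1)^{\mathrm{rinv}(\pi)}q^{\mathrm{rmaj}(\pi)} = \sum_{\pi\in G(r,n)}(-1)^{\mathrm{rmaj}(\pi)}q^{\mathrm{rinv}(\pi)} = \prod_{k=1}^n[r]_{(-q)^{k}}\,[k]_{(-1)^{k-1}q}.$$
   Context: For an integer $m\ge 0$ and any quantity $p$, $[m]_p:=1+p+\cdots+p^{m-1}$. $G(r,n)=C_r\wr\mathfrak S_n$ is the group of $r$-colored permutations; an element is a word $\pi=\pi_1\cdots\pi_n=\sigma_1^{[z_1]}\cdots\sigma_n^{[z_n]}$ with $\sigma\in\mathfrak S_n$ and colors $z_i\in\{0,1,\dots,r-1\}$, with $i^{[0]}=i$. The colored letters are ordered linearly by $$(1^{[r-1]}<\cdots<n^{[r-1]})<\cdots<(1^{[1]}<\cdots<n^{[1]})<(1<\cdots<n),$$ and with respect to this order $\mathrm{inv}(\pi):=|\{(i,j):i<j,\ \pi_i>\pi_j\}|$ and $\mathrm{maj}(\pi):=\sum_{1\le i\le n-1,\ \pi_i>\pi_{i+1}} i$. The root major index is $\mathrm{rmaj}(\pi):=\mathrm{maj}(\pi)+\sum_{i=1}^n z_i\sigma_i$, and the root inversion number is $\mathrm{rinv}(\pi):=\mathrm{inv}(\pi)+\sum_{i=1}^n z_i\sigma_i$. *)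

theory Defs
  imports Complex_Main "HOL-Combinatorics.Permutations" "HOL-Library.FuncSet"
begin

definition qnum :: "nat \<Rightarrow> 'a::comm_ring_1 \<Rightarrow> 'a" where
  "qnum m p = (\<Sum>i<m. p ^ i)"

text \<open>
  A colored letter \<open>a\<^sup>[\<^sup>c\<^sup>]\<close> is the pair \<open>(a, c)\<close>. Letters of larger color are smaller;
  letters of equal color are ordered by their value.
\<close>

definition letter_less :: "nat \<times> nat \<Rightarrow> nat \<times> nat \<Rightarrow> bool" where
  "letter_less x y \<longleftrightarrow> snd y < snd x \<or> (snd x = snd y \<and> fst x < fst y)"

text \<open>
  The underlying set of the wreath product of the cyclic group of order \<open>r\<close> with the
  symmetric group on \<open>{1..n}\<close>. The pair \<open>(\<sigma>, z)\<close> encodes the word whose \<open>i\<close>-th letter is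
  \<open>\<sigma> i\<close> with color \<open>z i\<close>, for \<open>1 \<le> i \<le> n\<close>; outside \<open>{1..n}\<close> both functions have a
  fixed default value, so that pairs and words correspond bijectively. The group
  multiplication plays no role for the statistics.
\<close>

definition colored_perms :: "nat \<Rightarrow> nat \<Rightarrow> ((nat \<Rightarrow> nat) \<times> (nat \<Rightarrow> nat)) set" where
  "colored_perms r n = {\<sigma>. \<sigma> permutes {1..n}} \<times> ({1..n} \<rightarrow>\<^sub>E {..<r})"

definition letter :: "(nat \<Rightarrow> nat) \<times> (nat \<Rightarrow> nat) \<Rightarrow> nat \<Rightarrow> nat \<times> nat" where
  "letter \<pi> i = (fst \<pi> i, snd \<pi> i)"

definition cinv :: "nat \<Rightarrow> (nat \<Rightarrow> nat) \<times> (nat \<Rightarrow> nat) \<Rightarrow> nat" where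
  "cinv n \<pi> = card {(i, j). i \<in> {1..n} \<and> j \<in> {1..n} \<and> i < j \<and>
                     letter_less (letter \<pi> j) (letter \<pi> i)}"

definition cmaj :: "nat \<Rightarrow> (nat \<Rightarrow> nat) \<times> (nat \<Rightarrow> nat) \<Rightarrow> nat" where
  "cmaj n \<pi> = (\<Sum>i | i \<in> {1..<n} \<and> letter_less (letter \<pi> (i + 1)) (letter \<pi> i). i)"

definition color_weight :: "nat \<Rightarrow> (nat \<Rightarrow> nat) \<times> (nat \<Rightarrow> nat) \<Rightarrow> nat" where
  "color_weight n \<pi> = (\<Sum>i=1..n. snd \<pi> i * fst \<pi> i)"

definition rmaj :: "nat \<Rightarrow> (nat \<Rightarrow> nat) \<times> (nat \<Rightarrow> nat) \<Rightarrow> nat" where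
  "rmaj n \<pi> = cmaj n \<pi> + color_weight n \<pi>"

definition rinv :: "nat \<Rightarrow> (nat \<Rightarrow> nat) \<times> (nat \<Rightarrow> nat) \<Rightarrow> nat" where
  "rinv n \<pi> = cinv n \<pi> + color_weight n \<pi>"

end

theory Submission
  imports Defs "HOL-Combinatorics.Multiset_Permutations"
begin

text \<open>
  The colors decouple from the order statistics. Read the color of a word as a function \<open>c\<close> of
  the value of the letter. For fixed \<open>c\<close> the letters form a set of \<open>n\<close> elements of a linear order,
  the words with these colors are all arrangements of that set, and \<open>inv\<close> and \<open>maj\<close> depend only
  on relative order. The extra summand is the sum of the \<open>k * c k\<close>. In both sums it contributes \<open>- q\<close> to
  this power, and summing over \<open>c\<close> gives the product over \<open>k\<close> of the numbers \<open>[r]\<close> with base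
  \<open>(- q) ^ k\<close> (\<open>sum_colored_perms\<close>). What remains is the case of one color: the sums of
  \<open>(-1) ^ inv * q ^ maj\<close> (Gessel and Simion) and of \<open>(-1) ^ maj * q ^ inv\<close> over the arrangements of
  an \<open>n\<close>-element linear order both equal the product of the \<open>[k]\<close> with base \<open>(-1) ^ (k - 1) * q\<close>.

  Signs create cancellations between words that differ in two letters, so both sums are computed
  in steps of two: from \<open>n\<close> to \<open>n + 2\<close> each is multiplied by the product of two consecutive factors,
  which is \<open>\<Sum>i<n+1. q ^ i * (1 - q ^ (i + 1))\<close> (\<open>pair_factor_eq_qnum\<close>). This form
  involves no division, so the argument works in every commutative ring.

  For the sign \<open>(-1) ^ maj\<close>, only descents at odd positions matter. Removing the first two letters shifts
  the positions by two and preserves the sign; the removed pair contributes a sum over ordered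
  pairs of ranks (\<open>sum_signed_power_ranks\<close>, \<open>sum_maj_sign_inv_step\<close>).

  For the sign \<open>(-1) ^ inv\<close>, insert the two largest letters \<open>u < v\<close> into a word \<open>xs\<close>. Exchanging them
  changes the parity of \<open>inv\<close>, and it leaves the descents alone unless they are adjacent. So
  only the words in which \<open>u\<close> and \<open>v\<close> are adjacent survive (\<open>sum_two_max_orders\<close>), and the sum over
  the gaps of \<open>xs\<close> of their contributions depends on \<open>xs\<close> only through the factor \<open>q ^ maj xs\<close>
  (\<open>sum_gaps\<close>), even though the individual contributions depend on all descents of \<open>xs\<close>.
\<close>

section \<open>Products of two consecutive factors\<close>

text \<open>
  If \<open>1 - q\<^sup>2\<close> is invertible, this is \<open>(1 - q ^ m) * (1 - q ^ (m + 1)) / (1 - q\<^sup>2)\<close>, that is, \<open>1 - q\<close> times the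
  Gaussian binomial coefficient of \<open>m + 1\<close> over \<open>2\<close>. The polynomial form keeps it meaningful for
  every \<open>q\<close>.
\<close>

definition pair_factor :: "'a::comm_ring_1 \<Rightarrow> nat \<Rightarrow> 'a" where
  "pair_factor q m = (\<Sum>i<m. q ^ i * (1 - q ^ Suc i))"

lemma pair_factor_0 [simp]: "pair_factor q 0 = 0"
  by (simp add: pair_factor_def)

lemma pair_factor_Suc: "pair_factor q (Suc m) = pair_factor q m + q ^ m * (1 - q ^ Suc m)"
  by (simp add: pair_factor_def)

text \<open>
  In the induction on words in \<open>sum_inner_gaps\<close>, this recursion accounts for appending a letter with a
  descent, and \<open>pair_factor_Suc\<close> for appending one with an ascent.
\<close>

lemma pair_factor_Suc': "pair_factor q (Suc m) = q\<^sup>2 * pair_factor q m + (1 - q ^ Suc m)"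
proof (induction m)
  case (Suc m)
  have "pair_factor q (Suc (Suc m)) =
          q\<^sup>2 * pair_factor q m + (1 - q ^ Suc m) + q ^ Suc m * (1 - q ^ Suc (Suc m))"
    by (simp only: pair_factor_Suc[of q "Suc m"] Suc.IH)
  also have "\<dots> = q\<^sup>2 * pair_factor q (Suc m) + (1 - q ^ Suc (Suc m))"
    by (simp add: pair_factor_Suc algebra_simps power2_eq_square)
  finally show ?case .
qed (simp add: pair_factor_Suc)

text \<open>
  With \<open>p = (-1) ^ m * q\<close>, the bases alternate between \<open>p\<close> and \<open>- p\<close>. Passing from \<open>m\<close> to \<open>m + 1\<close>
  replaces \<open>[m+1]\<close> by \<open>[m+3]\<close>, both with base \<open>p\<close>. The difference is \<open>p ^ (m + 1) * (1 + p)\<close>,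
  and \<open>1 + p\<close> times the other factor, which has base \<open>- p\<close>, telescopes to
  \<open>1 - (- p) ^ (m + 2)\<close>. The signs left over are powers of \<open>-1\<close> with exponent a product of two consecutive numbers.
\<close>

lemma pair_factor_eq_qnum:
  "pair_factor q (Suc m) = qnum (Suc m) ((-1) ^ m * q) * qnum (Suc (Suc m)) ((-1) ^ Suc m * q)"
proof (induction m)
  case 0
  show ?case by (simp add: pair_factor_def qnum_def numeral_2_eq_2)
next
  case (Suc m)
  define p where "p = (-1) ^ m * q"
  have pm: "p ^ Suc m = q ^ Suc m"
  proof -
    have "p ^ Suc m = (-1) ^ (m * Suc m) * q ^ Suc m"
      by (simp only: p_def power_mult_distrib power_mult)
    thus ?thesis by (simp add: minus_one_power_iff)
  qed
  have pn: "(- p) ^ Suc (Suc m) = q ^ Suc (Suc m)"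
  proof -
    have "(- p) ^ Suc (Suc m) = ((-1) ^ Suc m * q) ^ Suc (Suc m)"
      by (simp add: p_def)
    also have "\<dots> = (-1) ^ (Suc m * Suc (Suc m)) * q ^ Suc (Suc m)"
      by (simp only: power_mult_distrib power_mult)
    also have "even (Suc m * Suc (Suc m))" by simp
    hence "(-1) ^ (Suc m * Suc (Suc m)) = (1 :: 'a)" by (simp only: minus_one_power_iff if_True)
    finally show ?thesis by simp
  qed
  have geometric: "(1 + p) * qnum (Suc (Suc m)) (- p) = 1 - (- p) ^ Suc (Suc m)"
    using one_diff_power_eq[of "- p" "Suc (Suc m)"] by (simp add: qnum_def)
  have "pair_factor q (Suc (Suc m)) =
          qnum (Suc m) p * qnum (Suc (Suc m)) (- p) + p ^ Suc m * (1 - (- p) ^ Suc (Suc m))"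
    using Suc.IH by (simp only: pair_factor_Suc[of q "Suc m"] pm pn) (simp add: p_def)
  also have "\<dots> = qnum (Suc (Suc m)) (- p) * (qnum (Suc m) p + p ^ Suc m * (1 + p))"
    unfolding geometric[symmetric] by (simp add: algebra_simps)
  also have "qnum (Suc m) p + p ^ Suc m * (1 + p) = qnum (Suc (Suc (Suc m))) p"
    by (simp add: qnum_def algebra_simps)
  finally show ?case by (simp add: p_def)
qed

section \<open>Inversions and descents of words\<close>

fun list_inv :: "'b::linorder list \<Rightarrow> nat" where
  "list_inv [] = 0"
| "list_inv (x # xs) = length (filter (\<lambda>y. y < x) xs) + list_inv xs"

text \<open>
  The first letter has position \<open>k\<close>; the usual major index is \<open>maj_from 1\<close>. Free starting positions
  let a word be cut into factors that keep their positions.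
\<close>

fun maj_from :: "nat \<Rightarrow> 'b::linorder list \<Rightarrow> nat" where
  "maj_from k (x # y # zs) = (if y < x then k else 0) + maj_from (Suc k) (y # zs)"
| "maj_from k _ = 0"

lemma maj_from_snoc:
  "maj_from k (xs @ [x]) =
     maj_from k xs + (if xs \<noteq> [] \<and> x < last xs then k + length xs - 1 else 0)"
  by (induction k xs rule: maj_from.induct) auto

text \<open>
  The right-hand side does not mention \<open>u\<close>: a maximal letter is preceded by an ascent and, unless
  it is last, followed by a descent.
\<close>

lemma maj_from_insert_max:
  assumes "\<forall>y\<in>set (ys @ zs). y < u"
  shows "maj_from k (ys @ u # zs) =
     maj_from k ys + (if zs = [] then 0 else k + length ys) + maj_from (Suc (k + length ys)) zs"
  using assms
proof (induction k ys rule: maj_from.induct)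
  case ("2_1" k)
  then show ?case by (cases zs) auto
next
  case ("2_2" k y)
  then show ?case by (cases zs) auto
qed auto

lemma list_inv_insert_max:
  assumes "\<forall>y\<in>set (ys @ zs). y < u"
  shows "list_inv (ys @ u # zs) = list_inv (ys @ zs) + length zs"
  using assms by (induction ys) (auto simp: filter_id_conv)

lemma minus_one_power_maj_from_shift:
  "(-1) ^ maj_from (Suc (Suc k)) xs = ((-1) ^ maj_from k xs :: 'a::comm_ring_1)"
  by (induction k xs rule: maj_from.induct) (auto simp: power_add)

lemma sum_permutations_of_set_Cons:
  assumes "finite A" "A \<noteq> {}"
  shows "(\<Sum>xs\<in>permutations_of_set A. f xs) =
           (\<Sum>x\<in>A. \<Sum>ys\<in>permutations_of_set (A - {x}). f (x # ys))"
proof -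
  have "(\<Sum>xs\<in>permutations_of_set A. f xs) =
          (\<Sum>x\<in>A. \<Sum>xs\<in>(#) x ` permutations_of_set (A - {x}). f xs)"
    unfolding permutations_of_set_nonempty[OF assms(2)] using assms(1)
    by (subst sum.UNION_disjoint) auto
  also have "\<dots> = (\<Sum>x\<in>A. \<Sum>ys\<in>permutations_of_set (A - {x}). f (x # ys))"
    by (subst sum.reindex) (auto simp: inj_on_def)
  finally show ?thesis .
qed

lemma sum_permutations_of_set_insert:
  assumes "finite A" "a \<notin> A"
  shows "(\<Sum>xs\<in>permutations_of_set (insert a A). f xs) =
           (\<Sum>xs\<in>permutations_of_set A. \<Sum>j\<le>card A. f (take j xs @ a # drop j xs))"
proof -
  let ?ins = "\<lambda>(xs, j). take j xs @ a # drop j xs"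
  have inj: "inj_on ?ins (permutations_of_set A \<times> {..card A})"
  proof (rule inj_onI, clarify)
    fix xs i ys j
    assume xs: "xs \<in> permutations_of_set A" "i \<le> card A"
      and ys: "ys \<in> permutations_of_set A" "j \<le> card A"
      and eq: "take i xs @ a # drop i xs = take j ys @ a # drop j ys"
    have "a \<notin> set xs" "a \<notin> set ys"
      using xs ys assms by (auto simp: permutations_of_set_def)
    hence "a \<notin> set (take i xs)" "a \<notin> set (take j ys)" "a \<notin> set (drop i xs)" "a \<notin> set (drop j ys)"
      by (auto dest: in_set_takeD in_set_dropD)
    hence *: "take i xs = take j ys" "drop i xs = drop j ys"
      using eq by (auto simp: append_eq_Cons_conv append_eq_append_conv2 Cons_eq_append_conv)
    have "length xs = card A" "length ys = card A"
      using xs ys by (auto dest: length_finite_permutations_of_set)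
    hence "i = length (take i xs)" "j = length (take j ys)" using xs ys by auto
    thus "xs = ys \<and> i = j" using * by (metis append_take_drop_id)
  qed
  have "?ins ` (permutations_of_set A \<times> {..card A}) = permutations_of_set (insert a A)"
  proof (intro equalityI subsetI)
    fix w assume "w \<in> ?ins ` (permutations_of_set A \<times> {..card A})"
    then obtain xs j where w: "w = take j xs @ a # drop j xs" and xs: "xs \<in> permutations_of_set A"
      by auto
    have "mset (take j xs) + mset (drop j xs) = mset xs"
      by (metis append_take_drop_id mset_append)
    hence "mset w = add_mset a (mset xs)" unfolding w by simp
    thus "w \<in> permutations_of_set (insert a A)"
      using xs assms by (simp add: permutations_of_set_altdef permutations_of_multiset_def)
  next
    fix w assume w: "w \<in> permutations_of_set (insert a A)"
    then obtain ys zs where s: "w = ys @ a # zs"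
      by (metis insertI1 permutations_of_setD(1) split_list)
    have "ys @ zs \<in> permutations_of_set A"
      using w assms unfolding s by (auto simp: permutations_of_set_def)
    moreover from this have "length ys \<le> card A"
      by (auto dest: length_finite_permutations_of_set)
    ultimately show "w \<in> ?ins ` (permutations_of_set A \<times> {..card A})"
      unfolding s by (intro image_eqI[of _ _ "(ys @ zs, length ys)"]) auto
  qed
  hence "(\<Sum>xs\<in>permutations_of_set (insert a A). f xs) =
           (\<Sum>p\<in>permutations_of_set A \<times> {..card A}. f (?ins p))"
    using sum.reindex[OF inj, of f] by simp
  thus ?thesis by (simp add: sum.cartesian_product case_prod_unfold)
qed

section \<open>Sign given by the major index\<close>

lemma sum_power_rank:
  fixes A :: "'b::linorder set" and q :: "'a::comm_ring_1"
  assumes "finite A"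
  shows "(\<Sum>x\<in>A. q ^ card {a\<in>A. a < x}) = (\<Sum>i<card A. q ^ i)"
  using assms
proof (induction rule: finite_linorder_max_induct)
  case (insert m A)
  have m: "m \<notin> A" using insert.hyps by auto
  have "{a \<in> insert m A. a < m} = A" using insert.hyps by auto
  moreover have "{a \<in> insert m A. a < x} = {a \<in> A. a < x}" if "x \<in> A" for x
    using that insert.hyps by auto
  ultimately show ?case using insert m by simp
qed simp

text \<open>
  A new maximum \<open>m\<close> added to a set of \<open>k + 1\<close> letters takes part in the pairs \<open>(x, m)\<close>, of weight
  \<open>q ^ k\<close> times the power for the rank of \<open>x\<close>, and \<open>(m, y)\<close>, of weight \<open>- q ^ (k + 1)\<close> times the power
  for the rank of \<open>y\<close>. Together they give \<open>q ^ k * (1 - q)\<close> times a geometric sum, which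
  is the next summand of \<open>pair_factor\<close>.
\<close>

lemma sum_signed_power_ranks:
  fixes A :: "'b::linorder set" and q :: "'a::comm_ring_1"
  assumes "finite A"
  shows "(\<Sum>x\<in>A. \<Sum>y\<in>A - {x}. (if y < x then -1 else 1) *
            q ^ (card {a\<in>A. a < x} + card {a\<in>A - {x}. a < y})) = pair_factor q (card A - 1)"
  using assms
proof (induction rule: finite_linorder_max_induct)
  case (insert m A)
  define t :: "'b set \<Rightarrow> 'b \<Rightarrow> 'b \<Rightarrow> 'a" where
    "t A x y = (if y < x then -1 else 1) *
       q ^ (card {a\<in>A. a < x} + card {a\<in>A - {x}. a < y})" for A x y
  note IH = insert.IH[folded t_def]
  have m: "m \<notin> A" using insert.hyps by auto
  show ?case
  proof (cases "A = {}")
    case False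
    then obtain k where k: "card A = Suc k"
      using insert.hyps by (metis card_eq_0_iff not0_implies_Suc)
    have old: "t (insert m A) x y = t A x y" if "x \<in> A" "y \<in> A" for x y
    proof -
      have "{a \<in> insert m A. a < x} = {a \<in> A. a < x}"
        "{a \<in> insert m A - {x}. a < y} = {a \<in> A - {x}. a < y}"
        using that insert.hyps by auto
      thus ?thesis by (simp add: t_def)
    qed
    have last: "t (insert m A) x m = q ^ k * q ^ card {a\<in>A. a < x}" if "x \<in> A" for x
    proof -
      have "{a \<in> insert m A. a < x} = {a \<in> A. a < x}" "{a \<in> insert m A - {x}. a < m} = A - {x}"
        "\<not> m < x"
        using that insert.hyps by auto
      thus ?thesis using that k by (simp add: t_def power_add)
    qed
    have first: "t (insert m A) m y = - (q ^ Suc k * q ^ card {a\<in>A. a < y})" if "y \<in> A" for y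
    proof -
      have "{a \<in> insert m A. a < m} = A" "{a \<in> insert m A - {m}. a < y} = {a \<in> A. a < y}" "y < m"
        using that insert.hyps by auto
      thus ?thesis using k by (simp add: t_def power_add)
    qed
    have row: "(\<Sum>y\<in>insert m A - {x}. t (insert m A) x y) =
                 q ^ k * q ^ card {a\<in>A. a < x} + (\<Sum>y\<in>A - {x}. t A x y)" if "x \<in> A" for x
    proof -
      have "insert m A - {x} = insert m (A - {x})" using that m by auto
      thus ?thesis using that m insert.hyps(1) by (simp add: old last)
    qed
    have "(\<Sum>x\<in>insert m A. \<Sum>y\<in>insert m A - {x}. t (insert m A) x y) =
            (\<Sum>y\<in>A. t (insert m A) m y) + (\<Sum>x\<in>A. \<Sum>y\<in>insert m A - {x}. t (insert m A) x y)"
      using insert.hyps m by simp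
    also have "\<dots> = - (q ^ Suc k) * (\<Sum>y\<in>A. q ^ card {a\<in>A. a < y}) +
                 (q ^ k * (\<Sum>x\<in>A. q ^ card {a\<in>A. a < x}) + (\<Sum>x\<in>A. \<Sum>y\<in>A - {x}. t A x y))"
      by (simp only: first row sum.distrib sum_distrib_left sum_negf mult_minus_left cong: sum.cong)
    also have "\<dots> = pair_factor q k + q ^ k * ((1 - q) * (\<Sum>i<Suc k. q ^ i))"
      unfolding IH sum_power_rank[OF insert.hyps(1)] k by (simp add: algebra_simps)
    also have "\<dots> = pair_factor q (Suc k)"
      by (simp only: one_diff_power_eq[symmetric] pair_factor_Suc)
    finally show ?thesis using k m insert.hyps by (simp add: t_def)
  qed simp
qed simp

lemma list_inv_pair_Cons:
  assumes "x # y # zs \<in> permutations_of_set A"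
  shows "list_inv (x # y # zs) =
           card {a\<in>A. a < x} + card {a\<in>A - {x}. a < y} + list_inv zs"
proof -
  have d: "distinct (x # y # zs)" and A: "A = set (x # y # zs)"
    using assms by (auto simp: permutations_of_set_def)
  have "length (filter (\<lambda>a. a < x) (y # zs)) = card {a\<in>A. a < x}"
    unfolding A using d
    by (subst distinct_card[symmetric]) (auto intro!: arg_cong[of _ _ card] simp del: filter.simps)
  moreover have "length (filter (\<lambda>a. a < y) zs) = card {a\<in>A - {x}. a < y}"
    unfolding A using d
    by (subst distinct_card[symmetric]) (auto intro!: arg_cong[of _ _ card])
  ultimately show ?thesis by simp
qed

lemma sum_maj_sign_inv_step:
  fixes A :: "'b::linorder set" and q :: "'a::comm_ring_1"
  assumes A: "finite A" "card A = Suc (Suc n)"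
    and rest: "\<And>B :: 'b set. finite B \<Longrightarrow> card B = n \<Longrightarrow>
      (\<Sum>zs\<in>permutations_of_set B. (-1) ^ maj_from 1 zs * q ^ list_inv zs) = c"
  shows "(\<Sum>xs\<in>permutations_of_set A. (-1) ^ maj_from 1 xs * q ^ list_inv xs) =
           pair_factor q (Suc n) * c"
proof -
  let ?w = "\<lambda>xs :: 'b list. (-1) ^ maj_from 1 xs * q ^ list_inv xs"
  define t where "t x y = (if y < x then -1 else 1) *
      q ^ (card {a\<in>A. a < x} + card {a\<in>A - {x}. a < y})" for x y
  have row: "(\<Sum>xs\<in>permutations_of_set (A - {x}). ?w (x # xs)) = (\<Sum>y\<in>A - {x}. t x y * c)"
    if x: "x \<in> A" for x
  proof -
    have c1: "card (A - {x}) = Suc n" using A x by simp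
    hence ne: "A - {x} \<noteq> {}" by (metis card.empty nat.distinct(1))
    have "(\<Sum>xs\<in>permutations_of_set (A - {x}). ?w (x # xs)) =
            (\<Sum>y\<in>A - {x}. \<Sum>zs\<in>permutations_of_set (A - {x} - {y}). ?w (x # y # zs))"
      using A(1) ne by (intro sum_permutations_of_set_Cons) simp_all
    also have "\<dots> = (\<Sum>y\<in>A - {x}. t x y * c)"
    proof (rule sum.cong[OF refl])
      fix y assume y: "y \<in> A - {x}"
      have "?w (x # y # zs) = t x y * ?w zs"
        if zs: "zs \<in> permutations_of_set (A - {x} - {y})" for zs
      proof -
        have word: "x # y # zs \<in> permutations_of_set A"
          using x y zs by (auto simp: permutations_of_set_def)
        \<comment> \<open>A descent from \<open>y\<close> to the next letter is at position 2 and does not affect the sign.\<close>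
        have "(-1) ^ maj_from (Suc 1) (y # zs) = ((-1) ^ maj_from (Suc (Suc 1)) zs :: 'a)"
          by (cases zs) auto
        hence "(-1) ^ maj_from 1 (x # y # zs) =
                 ((if y < x then -1 else 1) * (-1) ^ maj_from 1 zs :: 'a)"
          by (simp add: minus_one_power_maj_from_shift)
        thus ?thesis
          unfolding list_inv_pair_Cons[OF word] t_def by (simp add: power_add mult_ac)
      qed
      hence "(\<Sum>zs\<in>permutations_of_set (A - {x} - {y}). ?w (x # y # zs)) =
              t x y * (\<Sum>zs\<in>permutations_of_set (A - {x} - {y}). ?w zs)"
        by (simp add: sum_distrib_left)
      also have "(\<Sum>zs\<in>permutations_of_set (A - {x} - {y}). ?w zs) = c"
        using A y c1 by (intro rest) auto
      finally show "(\<Sum>zs\<in>permutations_of_set (A - {x} - {y}). ?w (x # y # zs)) = t x y * c" .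
    qed
    finally show ?thesis .
  qed
  have "(\<Sum>xs\<in>permutations_of_set A. ?w xs) = (\<Sum>x\<in>A. \<Sum>y\<in>A - {x}. t x y * c)"
    using A row by (subst sum_permutations_of_set_Cons) auto
  also have "\<dots> = (\<Sum>x\<in>A. \<Sum>y\<in>A - {x}. t x y) * c"
    by (simp add: sum_distrib_right)
  also have "(\<Sum>x\<in>A. \<Sum>y\<in>A - {x}. t x y) = pair_factor q (Suc n)"
    using sum_signed_power_ranks[OF A(1), of q] A(2) by (simp add: t_def)
  finally show ?thesis .
qed

section \<open>Sign given by the inversion number\<close>

text \<open>
  The major index of the word obtained from \<open>xs\<close> by inserting two new largest letters, in
  increasing order, after the first \<open>j\<close> letters: they have positions \<open>j + 1\<close> and \<open>j + 2\<close>, and the second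
  one begins a descent unless it is last.
\<close>

definition gap_maj :: "'b::linorder list \<Rightarrow> nat \<Rightarrow> nat" where
  "gap_maj xs j = maj_from 1 (take j xs) + (if j < length xs then j + 2 else 0)
     + maj_from (j + 3) (drop j xs)"

lemma gap_maj_snoc:
  assumes "j < length xs"
  shows "gap_maj (xs @ [x]) j = gap_maj xs j + (if x < last xs then length xs + 2 else 0)"
  using assms by (auto simp: gap_maj_def maj_from_snoc)

text \<open>
  Appending a letter \<open>x\<close> to a word of length \<open>n\<close> adds the gap before \<open>x\<close>. If \<open>x\<close> creates a descent,
  this descent sits at position \<open>n\<close> in the word itself but at position \<open>n + 2\<close> after an insertion
  into an earlier gap. Relative to the power of \<open>q\<close> on the right-hand side, a descent therefore multiplies the
  sum over the earlier gaps by \<open>q\<^sup>2\<close> and the new gap adds \<open>1 - q ^ (n + 1)\<close>, whereas an ascent leaves the earlier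
  gaps unchanged and the new gap adds \<open>q ^ n * (1 - q ^ (n + 1))\<close>. These are the two recursions
  for \<open>pair_factor\<close>.
\<close>

lemma sum_inner_gaps:
  fixes q :: "'a::comm_ring_1"
  shows "(\<Sum>j<length xs. (1 - q ^ Suc j) * q ^ gap_maj xs j) =
           q ^ (maj_from 1 xs + 2) * pair_factor q (length xs)"
proof (induction xs rule: rev_induct)
  case (snoc x xs)
  let ?n = "length xs"
  define d where "d \<longleftrightarrow> xs \<noteq> [] \<and> x < last xs"
  define s where "s = (if d then q ^ (?n + 2) else 1)"
  have "gap_maj (xs @ [x]) ?n = maj_from 1 xs + ?n + 2"
    by (simp add: gap_maj_def)
  moreover have "q ^ gap_maj (xs @ [x]) j = s * q ^ gap_maj xs j" if "j < ?n" for j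
    using that by (auto simp: gap_maj_snoc s_def d_def power_add)
  ultimately have "(\<Sum>j<length (xs @ [x]). (1 - q ^ Suc j) * q ^ gap_maj (xs @ [x]) j) =
      s * (\<Sum>j<?n. (1 - q ^ Suc j) * q ^ gap_maj xs j) + (1 - q ^ Suc ?n) * q ^ (maj_from 1 xs + ?n + 2)"
    by (simp add: sum_distrib_left mult_ac)
  also have "\<dots> = q ^ (maj_from 1 xs + 2) *
      (s * pair_factor q ?n + q ^ ?n * (1 - q ^ Suc ?n))"
    unfolding snoc.IH by (simp add: algebra_simps power_add)
  also have "s * pair_factor q ?n + q ^ ?n * (1 - q ^ Suc ?n) =
      (if d then q ^ ?n else 1) * pair_factor q (Suc ?n)"
  proof (cases d)
    case True
    have "q ^ (?n + 2) * pair_factor q ?n + q ^ ?n * (1 - q ^ Suc ?n) =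
            q ^ ?n * pair_factor q (Suc ?n)"
      by (subst pair_factor_Suc') (simp add: algebra_simps power2_eq_square)
    thus ?thesis using True by (simp add: s_def)
  qed (simp add: s_def pair_factor_Suc)
  also have "q ^ (maj_from 1 xs + 2) * ((if d then q ^ ?n else 1) * pair_factor q (Suc ?n)) =
      q ^ (maj_from 1 (xs @ [x]) + 2) * pair_factor q (length (xs @ [x]))"
    by (auto simp: maj_from_snoc d_def power_add)
  finally show ?case .
qed simp

lemma sum_gaps:
  fixes q :: "'a::comm_ring_1"
  shows "(\<Sum>j\<le>length xs. (1 - q ^ Suc j) * q ^ gap_maj xs j) =
           q ^ maj_from 1 xs * pair_factor q (Suc (length xs))"
proof -
  have "gap_maj xs (length xs) = maj_from 1 xs" by (simp add: gap_maj_def)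
  thus ?thesis
    by (simp only: lessThan_Suc_atMost[symmetric] sum.lessThan_Suc sum_inner_gaps pair_factor_Suc')
       (simp add: algebra_simps power_add power2_eq_square)
qed

text \<open>
  All other letters are smaller than \<open>u\<close> and \<open>v\<close>, so exchanging the two changes the number of
  inversions by one. If \<open>ws\<close> is not empty, each of the two letters exceeds its neighbours in both
  orders, so the descents agree and the terms cancel.
  If \<open>ws\<close> is empty, the order \<open>v u\<close> has one more descent, at position \<open>length ys + 1\<close>.
\<close>

lemma sum_two_max_orders:
  fixes q :: "'a::comm_ring_1"
  assumes w: "\<forall>y\<in>set (ys @ ws @ zs). y < u" and uv: "u < v"
  defines "k \<equiv> length ys"
  shows "(-1) ^ list_inv (ys @ u # ws @ v # zs) * q ^ maj_from 1 (ys @ u # ws @ v # zs) +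
         (-1) ^ list_inv (ys @ v # ws @ u # zs) * q ^ maj_from 1 (ys @ v # ws @ u # zs) =
         (if ws = [] then
            (-1) ^ list_inv (ys @ zs) * ((1 - q ^ Suc k) * q ^ gap_maj (ys @ zs) k) else 0)"
proof -
  have v: "y < v" if "y \<in> set (ys @ ws @ zs)" for y using bspec[OF w that] uv by (rule less_trans)
  have w': "\<forall>y\<in>set (ys @ ws). y < u" using w by auto
  have inv_uv: "list_inv (ys @ u # ws @ v # zs) =
      list_inv (ys @ ws @ zs) + length ws + 2 * length zs"
    using list_inv_insert_max[of "ys @ u # ws" zs v] list_inv_insert_max[of ys "ws @ zs" u] w uv v
    by auto
  have inv_vu: "list_inv (ys @ v # ws @ u # zs) =
      Suc (list_inv (ys @ ws @ zs) + length ws + 2 * length zs)"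
    using list_inv_insert_max[of ys "ws @ u # zs" v] list_inv_insert_max[of "ys @ ws" zs u] w uv v
    by auto
  let ?end = "if zs = [] then 0 else k + length ws + 2"
  have maj_uv: "maj_from 1 (ys @ u # ws @ v # zs) =
      maj_from 1 ys + (if ws = [] then 0 else Suc k) + maj_from (k + 2) ws + ?end
        + maj_from (k + length ws + 3) zs"
    using maj_from_insert_max[of "ys @ u # ws" zs v 1] maj_from_insert_max[OF w', of 1] w uv v
    by (auto simp: k_def numeral_3_eq_3)
  have maj_vu: "maj_from 1 (ys @ v # ws @ u # zs) =
      maj_from 1 ys + Suc k + maj_from (k + 2) ws + ?end + maj_from (k + length ws + 3) zs"
    using maj_from_insert_max[of ys "ws @ u # zs" v 1] maj_from_insert_max[of ws zs u "k + 2"] w uv v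
    by (auto simp: k_def numeral_3_eq_3)
  show ?thesis
  proof (cases "ws = []")
    case True
    have "gap_maj (ys @ zs) k = maj_from 1 ys + ?end + maj_from (k + length ws + 3) zs"
      using True by (auto simp: gap_maj_def k_def)
    thus ?thesis
      unfolding inv_uv inv_vu maj_uv maj_vu using True
      by (simp add: power_add algebra_simps)
  next
    case False
    thus ?thesis unfolding inv_uv inv_vu maj_uv maj_vu by simp
  qed
qed

text \<open>
  Two letters are inserted one after the other, the first behind \<open>i\<close> letters and the second behind
  \<open>j\<close> letters of the enlarged word. The second one comes before the first one iff \<open>j \<le> i\<close>, and then exchanging the
  two letters yields the indices \<open>j\<close> and \<open>i + 1\<close>. The right-hand side collects these two arrangements.
\<close>

lemma sum_insertion_positions:
  fixes f :: "nat \<Rightarrow> nat \<Rightarrow> 'a::comm_monoid_add"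
  shows "(\<Sum>i\<le>n. \<Sum>j\<le>Suc n. f i j) = (\<Sum>i\<le>n. \<Sum>j\<le>i. f i j + f j (Suc i))"
proof (induction n)
  case (Suc n)
  have "(\<Sum>i\<le>Suc n. \<Sum>j\<le>Suc (Suc n). f i j) =
          (\<Sum>i\<le>n. \<Sum>j\<le>Suc n. f i j) + (\<Sum>i\<le>n. f i (Suc (Suc n))) + (\<Sum>j\<le>Suc (Suc n). f (Suc n) j)"
    by (simp add: sum.distrib ac_simps)
  also have "\<dots> = (\<Sum>i\<le>Suc n. \<Sum>j\<le>i. f i j + f j (Suc i))"
    unfolding Suc.IH by (simp add: sum.distrib ac_simps)
  finally show ?case .
qed simp

lemma sum_inv_sign_maj_step:
  fixes B :: "'b::linorder set" and q :: "'a::comm_ring_1"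
  assumes B: "finite B" and u: "\<forall>y\<in>B. y < u" and v: "\<forall>y\<in>insert u B. y < v"
  shows "(\<Sum>xs\<in>permutations_of_set (insert v (insert u B)). (-1) ^ list_inv xs * q ^ maj_from 1 xs) =
           pair_factor q (Suc (card B)) *
           (\<Sum>xs\<in>permutations_of_set B. (-1) ^ list_inv xs * q ^ maj_from 1 xs)"
proof -
  let ?w = "\<lambda>xs :: 'b list. (-1) ^ list_inv xs * q ^ maj_from 1 xs"
  have fresh: "u \<notin> B" "v \<notin> insert u B" using u v by auto
  let ?g = "\<lambda>xs i j. ?w (take j (take i xs @ u # drop i xs) @ v # drop j (take i xs @ u # drop i xs))"
  have fibre: "(\<Sum>i\<le>card B. \<Sum>j\<le>Suc (card B). ?g xs i j) =
      pair_factor q (Suc (card B)) * ?w xs"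
    if xs: "xs \<in> permutations_of_set B" for xs
  proof -
    let ?f = "?g xs"
    have n: "length xs = card B" and set: "set xs = B"
      using xs by (auto simp: length_finite_permutations_of_set permutations_of_setD)
    \<comment> \<open>For \<open>j \<le> i\<close> the word weighted by \<open>?f i j\<close> contains \<open>v ws u\<close> and the one
      weighted by \<open>?f j (Suc i)\<close> contains \<open>u ws v\<close>, where \<open>ws\<close> consists of the letters of \<open>xs\<close> in between; it is empty iff \<open>j = i\<close>.\<close>
    have pair: "?f i j + ?f j (Suc i) =
        (if j = i then (-1) ^ list_inv xs * ((1 - q ^ Suc j) * q ^ gap_maj xs j) else 0)"
      if ij: "j \<le> i" "i \<le> card B" for i j
    proof -
      define ys ws zs where "ys = take j xs" and "ws = take (i - j) (drop j xs)"
        and "zs = drop i xs"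
      have split: "xs = ys @ ws @ zs"
        using ij by (simp add: ys_def ws_def zs_def) (metis append_take_drop_id drop_drop le_add_diff_inverse2)
      have len: "length ys = j" "length ws = i - j"
        using ij n by (auto simp: ys_def ws_def)
      have "?f i j = ?w (ys @ v # ws @ u # zs)" "?f j (Suc i) = ?w (ys @ u # ws @ v # zs)"
        using ij len by (simp_all add: split Suc_diff_le)
      moreover have "\<forall>y\<in>set (ys @ ws @ zs). y < u" using u set split by simp
      moreover have "ws = [] \<longleftrightarrow> j = i" using len ij by auto
      ultimately show ?thesis
        using sum_two_max_orders[of ys ws zs u v q] v len split by (auto simp: add.commute)
    qed
    have "(\<Sum>i\<le>card B. \<Sum>j\<le>Suc (card B). ?f i j) = (\<Sum>i\<le>card B. \<Sum>j\<le>i. ?f i j + ?f j (Suc i))"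
      by (rule sum_insertion_positions)
    also have "\<dots> = (\<Sum>i\<le>card B. \<Sum>j\<le>i.
        (if j = i then (-1) ^ list_inv xs * ((1 - q ^ Suc j) * q ^ gap_maj xs j) else 0))"
      by (intro sum.cong refl pair) auto
    also have "\<dots> = (-1) ^ list_inv xs * (\<Sum>i\<le>length xs. (1 - q ^ Suc i) * q ^ gap_maj xs i)"
      by (simp add: n sum_distrib_left)
    also have "\<dots> = pair_factor q (Suc (card B)) * ?w xs"
      unfolding sum_gaps by (simp add: n mult_ac)
    finally show ?thesis .
  qed
  have "(\<Sum>xs\<in>permutations_of_set (insert v (insert u B)). ?w xs) =
      (\<Sum>xs\<in>permutations_of_set B. \<Sum>i\<le>card B. \<Sum>j\<le>Suc (card B). ?g xs i j)"
    using B fresh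
    by (subst sum_permutations_of_set_insert[of "insert u B" v] sum_permutations_of_set_insert[of B u],
        simp_all)+
  also have "\<dots> = (\<Sum>xs\<in>permutations_of_set B. pair_factor q (Suc (card B)) * ?w xs)"
    by (intro sum.cong refl fibre)
  finally show ?thesis by (simp add: sum_distrib_left)
qed

section \<open>The signed Mahonian identities for one color\<close>

lemma prod_qnum_two_step:
  "pair_factor q (Suc n) * (\<Prod>k=1..n. qnum k ((-1) ^ (k - 1) * q)) =
     (\<Prod>k=1..Suc (Suc n). qnum k ((-1) ^ (k - 1) * q))"
  by (simp add: pair_factor_eq_qnum mult_ac)

theorem signed_Mahonian_maj_sign:
  fixes A :: "'b::linorder set" and q :: "'a::comm_ring_1"
  assumes "finite A"
  shows "(\<Sum>xs\<in>permutations_of_set A. (-1) ^ maj_from 1 xs * q ^ list_inv xs) =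
           (\<Prod>k=1..card A. qnum k ((-1) ^ (k - 1) * q))"
  using assms
proof (induction "card A" arbitrary: A rule: induct_nat_012)
  case 0
  then show ?case by simp
next
  case 1
  then obtain x where "A = {x}" by (metis One_nat_def card_1_singletonE)
  then show ?case by (simp add: qnum_def)
next
  case (ge2 n)
  show ?case
    using sum_maj_sign_inv_step[OF ge2.prems ge2.hyps(3)[symmetric], of q] ge2.hyps(1)
    unfolding ge2.hyps(3)[symmetric] prod_qnum_two_step[symmetric] by auto
qed

theorem signed_Mahonian_inv_sign:
  fixes A :: "'b::linorder set" and q :: "'a::comm_ring_1"
  assumes "finite A"
  shows "(\<Sum>xs\<in>permutations_of_set A. (-1) ^ list_inv xs * q ^ maj_from 1 xs) =
           (\<Prod>k=1..card A. qnum k ((-1) ^ (k - 1) * q))"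
  using assms
proof (induction "card A" arbitrary: A rule: induct_nat_012)
  case 0
  then show ?case by simp
next
  case 1
  then obtain x where "A = {x}" by (metis One_nat_def card_1_singletonE)
  then show ?case by (simp add: qnum_def)
next
  case (ge2 n)
  define v where "v = Max A"
  define u where "u = Max (A - {v})"
  define B where "B = A - {v} - {u}"
  have "A \<noteq> {}" using ge2.hyps by auto
  hence vA: "v \<in> A" unfolding v_def using ge2.prems by simp
  hence c: "card (A - {v}) = Suc n" using ge2.hyps ge2.prems by simp
  hence "A - {v} \<noteq> {}" by (metis card.empty nat.distinct(1))
  hence uA: "u \<in> A - {v}" unfolding u_def using ge2.prems by (intro Max_in) auto
  have A: "A = insert v (insert u B)" using vA uA by (auto simp: B_def)
  have "finite B" "card B = n" using c uA ge2.prems by (auto simp: B_def)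
  moreover have "\<forall>y\<in>B. y < u"
    unfolding u_def B_def using ge2.prems by (auto simp: less_le)
  moreover have "\<forall>y\<in>insert u B. y < v"
    using uA unfolding v_def B_def using ge2.prems by (auto simp: less_le)
  ultimately have "(\<Sum>xs\<in>permutations_of_set A. (-1) ^ list_inv xs * q ^ maj_from 1 xs) =
      pair_factor q (Suc n) * (\<Prod>k=1..n. qnum k ((-1) ^ (k - 1) * q))"
    using sum_inv_sign_maj_step[of B u v q] ge2.hyps(1)[of B] unfolding A by simp
  thus ?case unfolding ge2.hyps(3)[symmetric] prod_qnum_two_step .
qed

section \<open>Colored words\<close>

lemma list_inv_eq_card:
  "list_inv xs = card {(i, j). i < j \<and> j < length xs \<and> xs ! j < xs ! i}"
proof (induction xs)
  case (Cons x xs)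
  let ?P = "\<lambda>xs. {(i, j). i < j \<and> j < length xs \<and> xs ! j < xs ! i}"
  let ?J = "{j. j < length xs \<and> xs ! j < x}"
  have split: "?P (x # xs) = (\<lambda>j. (0, Suc j)) ` ?J \<union> map_prod Suc Suc ` ?P xs" (is "_ = ?R")
  proof (intro equalityI subsetI)
    fix p assume p: "p \<in> ?P (x # xs)"
    obtain i j where ij: "p = (i, Suc j)" "i \<le> j" "j < length xs" "xs ! j < (x # xs) ! i"
      using p by (cases p; cases "snd p") auto
    show "p \<in> ?R" using ij by (cases i) (auto simp: map_prod_def image_iff)
  qed auto
  have fin: "finite (?P xs)"
    by (rule finite_subset[of _ "{..<length xs} \<times> {..<length xs}"]) auto
  have "card (?P (x # xs)) = card ((\<lambda>j. (0::nat, Suc j)) ` ?J) + card (map_prod Suc Suc ` ?P xs)"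
    unfolding split using fin by (intro card_Un_disjoint) auto
  also have "card ((\<lambda>j. (0::nat, Suc j)) ` ?J) = length (filter (\<lambda>y. y < x) xs)"
    by (subst card_image) (auto simp: inj_on_def length_filter_conv_card)
  also have "card (map_prod Suc Suc ` ?P xs) = list_inv xs"
    unfolding Cons.IH by (intro card_image) (auto simp: inj_on_def)
  finally show ?case by simp
qed simp

lemma maj_from_eq_sum:
  "maj_from k xs = (\<Sum>i | Suc i < length xs \<and> xs ! Suc i < xs ! i. k + i)"
proof (induction k xs rule: maj_from.induct)
  case (1 k x y zs)
  let ?D = "\<lambda>xs. {i. Suc i < length xs \<and> xs ! Suc i < xs ! i}"
  have fin: "finite (?D (y # zs))"
    by (rule finite_subset[of _ "{..length zs}"]) auto
  have D: "?D (x # y # zs) = (if y < x then {0} else {}) \<union> Suc ` ?D (y # zs)" (is "_ = ?R")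
  proof (rule set_eqI)
    fix i show "i \<in> ?D (x # y # zs) \<longleftrightarrow> i \<in> ?R" by (cases i) auto
  qed
  have "(\<Sum>i\<in>?D (x # y # zs). k + i) =
          (\<Sum>i\<in>(if y < x then {0} else {}). k + i) + (\<Sum>i\<in>Suc ` ?D (y # zs). k + i)"
    unfolding D using fin by (intro sum.union_disjoint) auto
  also have "(\<Sum>i\<in>Suc ` ?D (y # zs). k + i) = (\<Sum>i\<in>?D (y # zs). Suc k + i)"
    by (subst sum.reindex) auto
  also have "\<dots> = maj_from (Suc k) (y # zs)" using 1 by simp
  finally show ?case by simp
qed auto

text \<open>
  On letters with values in \<open>{1..n}\<close> this is an order embedding into the integers: values differ by
  less than \<open>n + 1\<close>, so the color dominates the comparison. It makes the results on words over a linear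
  order applicable.
\<close>

definition letter_code :: "nat \<Rightarrow> nat \<times> nat \<Rightarrow> int" where
  "letter_code n x = int (fst x) - int (snd x) * int (Suc n)"

lemma letter_code_less_iff:
  assumes "fst x \<in> {1..n}" "fst y \<in> {1..n}"
  shows "letter_code n x < letter_code n y \<longleftrightarrow> letter_less x y"
proof -
  have lt: "letter_code n x < letter_code n y"
    if "snd y < snd x" "fst x \<in> {1..n}" "fst y \<in> {1..n}" for x y :: "nat \<times> nat"
  proof -
    have "Suc (snd y) * Suc n \<le> snd x * Suc n" using that by (intro mult_right_mono) auto
    hence "int (Suc (snd y) * Suc n) \<le> int (snd x * Suc n)" by (simp only: of_nat_le_iff)
    thus ?thesis using that by (simp add: letter_code_def algebra_simps)
  qed
  show ?thesis
    using lt[of x y] lt[of y x] assms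
    by (cases "snd x" "snd y" rule: linorder_cases) (auto simp: letter_less_def letter_code_def)
qed

definition code_word :: "nat \<Rightarrow> (nat \<Rightarrow> nat) \<times> (nat \<Rightarrow> nat) \<Rightarrow> int list" where
  "code_word n \<pi> = map (\<lambda>i. letter_code n (letter \<pi> i)) [1..<Suc n]"

lemma code_word_less_iff:
  assumes "fst \<pi> permutes {1..n}" "i < n" "j < n"
  shows "code_word n \<pi> ! j < code_word n \<pi> ! i \<longleftrightarrow>
           letter_less (letter \<pi> (Suc j)) (letter \<pi> (Suc i))"
  using assms permutes_in_image[OF assms(1)]
  by (simp add: code_word_def letter_code_less_iff letter_def nth_append del: upt_Suc)

lemma cinv_eq_list_inv:
  assumes "fst \<pi> permutes {1..n}"
  shows "cinv n \<pi> = list_inv (code_word n \<pi>)"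
proof -
  have "{(i, j). i \<in> {1..n} \<and> j \<in> {1..n} \<and> i < j \<and> letter_less (letter \<pi> j) (letter \<pi> i)} =
        map_prod Suc Suc ` {(i, j). i < j \<and> j < n \<and> code_word n \<pi> ! j < code_word n \<pi> ! i}"
    (is "?L = _ ` ?R")
  proof (intro equalityI subsetI)
    fix p assume "p \<in> ?L"
    then obtain i j where "p = (Suc i, Suc j)" "i < j" "j < n"
        "letter_less (letter \<pi> (Suc j)) (letter \<pi> (Suc i))"
      by (cases p; cases "fst p"; cases "snd p") auto
    thus "p \<in> map_prod Suc Suc ` ?R"
      using code_word_less_iff[OF assms, of i j] by (intro image_eqI[of _ _ "(i, j)"]) auto
  qed (use code_word_less_iff[OF assms] in auto)
  hence "cinv n \<pi> = card (map_prod Suc Suc ` ?R)" by (simp only: cinv_def)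
  also have "\<dots> = list_inv (code_word n \<pi>)"
    by (subst card_image) (auto simp: inj_on_def list_inv_eq_card code_word_def)
  finally show ?thesis .
qed

lemma cmaj_eq_maj_from:
  assumes "fst \<pi> permutes {1..n}"
  shows "cmaj n \<pi> = maj_from 1 (code_word n \<pi>)"
proof -
  have "{i \<in> {1..<n}. letter_less (letter \<pi> (i + 1)) (letter \<pi> i)} =
        Suc ` {i. Suc i < n \<and> code_word n \<pi> ! Suc i < code_word n \<pi> ! i}" (is "?L = _ ` ?R")
  proof (intro equalityI subsetI)
    fix k assume "k \<in> ?L"
    then obtain i where "k = Suc i" "Suc i < n" "letter_less (letter \<pi> (Suc (Suc i))) (letter \<pi> (Suc i))"
      by (cases k) auto
    thus "k \<in> Suc ` ?R" using code_word_less_iff[OF assms, of i "Suc i"] by auto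
  qed (use code_word_less_iff[OF assms] in auto)
  hence "cmaj n \<pi> = (\<Sum>i\<in>Suc ` ?R. i)" by (simp only: cmaj_def)
  also have "\<dots> = maj_from 1 (code_word n \<pi>)"
    by (subst sum.reindex) (auto simp: maj_from_eq_sum code_word_def)
  finally show ?thesis .
qed

lemma bij_betw_map_permutes:
  "bij_betw (\<lambda>\<sigma>. map \<sigma> [1..<Suc n]) {\<sigma>. \<sigma> permutes {1..n}} (permutations_of_set {1..n})"
proof (rule bij_betw_imageI)
  let ?f = "\<lambda>\<sigma> :: nat \<Rightarrow> nat. map \<sigma> [1..<Suc n]"
  show inj: "inj_on ?f {\<sigma>. \<sigma> permutes {1..n}}"
  proof (rule inj_onI, clarify)
    fix \<sigma> \<tau> assume "\<sigma> permutes {1..n}" "\<tau> permutes {1..n}" "?f \<sigma> = ?f \<tau>"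
    hence "\<sigma> i = \<tau> i" for i
      by (cases "i \<in> {1..n}") (auto simp: permutes_not_in simp del: upt_Suc)
    thus "\<sigma> = \<tau>" by blast
  qed
  show "?f ` {\<sigma>. \<sigma> permutes {1..n}} = permutations_of_set {1..n}"
  proof (rule card_subset_eq)
    show "?f ` {\<sigma>. \<sigma> permutes {1..n}} \<subseteq> permutations_of_set {1..n}"
      by (auto simp: permutations_of_set_def distinct_map permutes_image permutes_inj_on
            atLeastLessThanSuc_atLeastAtMost simp del: upt_Suc)
    show "card (?f ` {\<sigma>. \<sigma> permutes {1..n}}) = card (permutations_of_set {1..n})"
      unfolding card_image[OF inj] by (subst card_permutations[OF refl]) simp_all
  qed simp
qed

text \<open>
  In the domain colors are attached to values, in the codomain to positions.
\<close>

lemma bij_betw_color_values: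
  fixes S :: "'b set" and T :: "'c set"
  shows "bij_betw (\<lambda>(\<sigma>, c). (\<sigma>, restrict (c \<circ> \<sigma>) S))
     ({\<sigma>. \<sigma> permutes S} \<times> (S \<rightarrow>\<^sub>E T)) ({\<sigma>. \<sigma> permutes S} \<times> (S \<rightarrow>\<^sub>E T))"
proof -
  have inverse: "restrict (restrict (c \<circ> \<tau>) S \<circ> \<sigma>) S = c"
    if "\<sigma> permutes S" "c \<in> S \<rightarrow>\<^sub>E T" "\<And>i. \<tau> (\<sigma> i) = i"
    for \<sigma> \<tau> c
    using permutes_in_image[OF that(1)] that(2,3)
    by (auto simp: fun_eq_iff PiE_iff extensional_def)
  show ?thesis 
    by (rule bij_betwI[where g = "\<lambda>(\<sigma>, z). (\<sigma>, restrict (z \<circ> inv \<sigma>) S)"])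
       (auto simp: inverse permutes_inv permutes_inverses simp del: restrict_apply,
        simp_all, (metis PiE_mem permutes_in_image permutes_inv)+)
qed

text \<open>
  Here \<open>F\<close> stands for a weight whose sum over all arrangements of a set depends only on the
  size of the set. For a fixed assignment \<open>c\<close> of colors to values, the word runs over the
  arrangements of the set of codes of the letters \<open>(a, c a)\<close>, and the color weight is constant, equal
  to the sum of the \<open>k * c k\<close>; the sum over \<open>c\<close> then splits into a product over the values.
\<close>

lemma sum_colored_perms:
  fixes F :: "int list \<Rightarrow> 'a::comm_ring_1" and p :: 'a
  assumes F: "\<And>A. finite A \<Longrightarrow> card A = n \<Longrightarrow> (\<Sum>xs\<in>permutations_of_set A. F xs) = C"
  shows "(\<Sum>\<pi>\<in>colored_perms r n. p ^ color_weight n \<pi> * F (code_word n \<pi>)) =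
           (\<Prod>k=1..n. qnum r (p ^ k)) * C"
proof -
  let ?S = "{\<sigma>. \<sigma> permutes {1..n}}" and ?C = "{1..n} \<rightarrow>\<^sub>E {..<r}"
  let ?h = "\<lambda>(\<sigma>, c). (\<sigma>, restrict (c \<circ> \<sigma>) {1..n})"
  have weight: "color_weight n (\<sigma>, restrict (c \<circ> \<sigma>) {1..n}) = (\<Sum>k=1..n. k * c k)" if "\<sigma> permutes {1..n}" for \<sigma> c
  proof -
    have "color_weight n (\<sigma>, restrict (c \<circ> \<sigma>) {1..n}) = (\<Sum>i=1..n. \<sigma> i * c (\<sigma> i))"
      by (simp add: color_weight_def mult.commute)
    also have "\<dots> = (\<Sum>k=1..n. k * c k)"
      using sum.permute[OF that, of "\<lambda>k. k * c k"] by (simp add: o_def)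
    finally show ?thesis .
  qed
  have words: "(\<Sum>\<sigma>\<in>?S. F (code_word n (?h (\<sigma>, c)))) = C" for c
  proof -
    let ?l = "\<lambda>a. letter_code n (a, c a)"
    have inj: "inj_on ?l {1..n}"
    proof (rule inj_onI)
      fix a b assume ab: "a \<in> {1..n}" "b \<in> {1..n}" "?l a = ?l b"
      hence "\<not> letter_less (a, c a) (b, c b)" "\<not> letter_less (b, c b) (a, c a)"
        by (simp_all flip: letter_code_less_iff[of _ n])
      thus "a = b" by (simp add: letter_less_def) arith
    qed
    have "(\<Sum>\<sigma>\<in>?S. F (code_word n (?h (\<sigma>, c)))) = (\<Sum>\<sigma>\<in>?S. F (map ?l (map \<sigma> [1..<Suc n])))"
      by (intro sum.cong refl arg_cong[of _ _ F]) (auto simp: code_word_def letter_def simp del: upt_Suc)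
    also have "\<dots> = (\<Sum>xs\<in>permutations_of_set {1..n}. F (map ?l xs))"
      by (rule sum.reindex_bij_betw[OF bij_betw_map_permutes])
    also have "\<dots> = (\<Sum>xs\<in>permutations_of_set (?l ` {1..n}). F xs)"
      unfolding permutations_of_set_image_inj[OF inj]
    proof (subst sum.reindex)
      show "inj_on (map ?l) (permutations_of_set {1..n})"
        by (rule inj_onI, rule map_inj_on[of ?l]) (simp_all add: permutations_of_setD(1) inj del: One_nat_def)
    qed simp
    also have "\<dots> = C" using inj by (intro F) (simp_all add: card_image)
    finally show ?thesis .
  qed
  have "(\<Sum>\<pi>\<in>colored_perms r n. p ^ color_weight n \<pi> * F (code_word n \<pi>)) =
          (\<Sum>x\<in>?S \<times> ?C. p ^ color_weight n (?h x) * F (code_word n (?h x)))"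
    unfolding colored_perms_def by (rule sum.reindex_bij_betw[OF bij_betw_color_values, symmetric])
  also have "\<dots> = (\<Sum>\<sigma>\<in>?S. \<Sum>c\<in>?C. p ^ (\<Sum>k=1..n. k * c k) * F (code_word n (?h (\<sigma>, c))))"
    unfolding sum.cartesian_product by (intro sum.cong refl) (auto simp: weight simp del: One_nat_def)
  also have "\<dots> = (\<Sum>c\<in>?C. p ^ (\<Sum>k=1..n. k * c k) * (\<Sum>\<sigma>\<in>?S. F (code_word n (?h (\<sigma>, c)))))"
    unfolding sum_distrib_left by (rule sum.swap)
  also have "\<dots> = (\<Sum>c\<in>?C. \<Prod>k=1..n. (p ^ k) ^ c k) * C"
    by (simp only: words sum_distrib_right power_sum power_mult)
  also have "(\<Sum>c\<in>?C. \<Prod>k=1..n. (p ^ k) ^ c k) = (\<Prod>k=1..n. qnum r (p ^ k))"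
    by (simp add: qnum_def prod_sum_PiE)
  finally show ?thesis .
qed

theorem theorem5p5:
  fixes r n :: nat and q :: "'a::comm_ring_1"
  assumes "r \<ge> 1" and "n \<ge> 1"
  shows "(\<Sum>\<pi>\<in>colored_perms r n. (-1) ^ rinv n \<pi> * q ^ rmaj n \<pi>)
           = (\<Sum>\<pi>\<in>colored_perms r n. (-1) ^ rmaj n \<pi> * q ^ rinv n \<pi>)
       \<and> (\<Sum>\<pi>\<in>colored_perms r n. (-1) ^ rmaj n \<pi> * q ^ rinv n \<pi>)
           = (\<Prod>k=1..n. qnum r ((- q) ^ k) * qnum k ((-1) ^ (k - 1) * q))"
proof -
  let ?C = "\<Prod>k=1..n. qnum k ((-1) ^ (k - 1) * q)"
  have split: "(-1) ^ rinv n \<pi> * q ^ rmaj n \<pi> = (- q) ^ color_weight n \<pi> *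
        ((-1) ^ list_inv (code_word n \<pi>) * q ^ maj_from 1 (code_word n \<pi>))"
    "(-1) ^ rmaj n \<pi> * q ^ rinv n \<pi> = (- q) ^ color_weight n \<pi> *
        ((-1) ^ maj_from 1 (code_word n \<pi>) * q ^ list_inv (code_word n \<pi>))"
    if "\<pi> \<in> colored_perms r n" for \<pi>
  proof -
    have "fst \<pi> permutes {1..n}" using that by (auto simp: colored_perms_def)
    thus "(-1) ^ rinv n \<pi> * q ^ rmaj n \<pi> = (- q) ^ color_weight n \<pi> *
        ((-1) ^ list_inv (code_word n \<pi>) * q ^ maj_from 1 (code_word n \<pi>))"
      "(-1) ^ rmaj n \<pi> * q ^ rinv n \<pi> = (- q) ^ color_weight n \<pi> *
        ((-1) ^ maj_from 1 (code_word n \<pi>) * q ^ list_inv (code_word n \<pi>))"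
      unfolding rinv_def rmaj_def power_minus[of q]
      by (simp_all add: cinv_eq_list_inv cmaj_eq_maj_from power_add mult_ac)
  qed
  let ?P = "\<Prod>k=1..n. qnum r ((- q) ^ k)"
  have "(\<Sum>\<pi>\<in>colored_perms r n. (-1) ^ rinv n \<pi> * q ^ rmaj n \<pi>) = ?P * ?C"
    by (subst sum.cong[OF refl split(1)], assumption, rule sum_colored_perms)
       (simp add: signed_Mahonian_inv_sign[simplified])
  moreover have "(\<Sum>\<pi>\<in>colored_perms r n. (-1) ^ rmaj n \<pi> * q ^ rinv n \<pi>) = ?P * ?C"
    by (subst sum.cong[OF refl split(2)], assumption, rule sum_colored_perms)
       (simp add: signed_Mahonian_maj_sign[simplified])
  ultimately show ?thesis by (simp only: prod.distrib)
qed

end
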